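(* The $P_2$ set $\{41,239,478\}$ is non-extendable; that is, there is no positive integer $m\notin\{41,239,478\}$ such that $\{41,239,478,m\}$ is a $P_2$ set.
   Context: Let $n$ be an integer. A set $\{a_1,\dots,a_r\}$ of $r$ distinct positive integers has the property $D(n)$, and is called a $P_n$ set of size $r$ (or a Diophantine $r$-tuple with the property $D(n)$), if $a_ia_j+n$ is a perfect square (the square of an integer) for all $1\le i<j\le r$. A $P_n$ set of size 3 is called non-extendable if it cannot be enlarged to a $P_n$ set of size 4 (a Diophantine quadruple with the property $D(n)$) by adjoining a further positive integer distinct from its elements. *)

theory Defs
  imports "HOL-Computational_Algebra.Nth_Powers"
begin

text \<open>
  Since \<open>n\<close> may be negative, \<open>a\<^sub>i a\<^sub>j + n\<close> has to be formed in the integers, so the elements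
  are integers with an explicit positivity condition. The condition on \<open>a\<^sub>i a\<^sub>j + n\<close> is symmetric in the indices, so \<open>i < j\<close>
  becomes a condition on all pairs of distinct elements.
\<close>

definition P_set :: "int \<Rightarrow> nat \<Rightarrow> int set \<Rightarrow> bool" where
  "P_set n r A \<longleftrightarrow> finite A \<and> card A = r \<and> (\<forall>a\<in>A. 0 < a) \<and>
     pairwise (\<lambda>a b. is_square (a * b + n)) A"

definition non_extendable :: "int \<Rightarrow> int set \<Rightarrow> bool" where
  "non_extendable n A \<longleftrightarrow> P_set n 3 A \<and>
     \<not> (\<exists>m>0. m \<notin> A \<and> P_set n 4 (insert m A))"

end

theory Submission
  imports Defs
begin

text \<open>
  The obstruction is local at \<open>2\<close>. Suppose that \<open>41 m + 2\<close>, \<open>239 m + 2\<close> and \<open>478 m + 2\<close> are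
  squares. The last one is an even square, hence divisible by \<open>4\<close> (\<open>even_square_dvd_4\<close>), which
  forces \<open>m\<close> to be odd. The first two are then odd squares, hence both \<open>1\<close> modulo \<open>8\<close>
  (\<open>odd_square_dvd_8\<close>), with sum \<open>2\<close> modulo \<open>8\<close>. But their sum is
  \<open>280 m + 4 \<equiv> 4\<close> modulo \<open>8\<close>, a contradiction.
\<close>

lemma even_square_dvd_4:
  fixes k :: int
  assumes "is_square k" "even k"
  shows "4 dvd k"
proof -
  obtain x where "k = x\<^sup>2"
    using assms(1) by (auto elim: is_nth_powerE)
  moreover from this have "even x"
    using assms(2) by simp
  ultimately show ?thesis
    by (auto elim!: evenE simp: power_mult_distrib)
qed

text \<open>
  The root is \<open>2 x + 1\<close>, and one of the consecutive integers \<open>x\<close> and \<open>x + 1\<close> is even.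
\<close>

lemma odd_square_dvd_8:
  fixes k :: int
  assumes "is_square k" "odd k"
  shows "8 dvd k - 1"
proof -
  obtain y where y: "k = y\<^sup>2"
    using assms(1) by (auto elim: is_nth_powerE)
  then have "odd y"
    using assms(2) by simp
  then obtain x where "y = 2 * x + 1"
    by (elim oddE)
  with y have "k - 1 = 4 * (x * (x + 1))"
    by (simp add: power2_eq_square algebra_simps)
  moreover have "4 * 2 dvd 4 * (x * (x + 1))"
    by (rule mult_dvd_mono) simp_all
  ultimately show ?thesis
    by simp
qed

lemma not_all_squares:
  fixes m :: int
  assumes "is_square (41 * m + 2)" "is_square (239 * m + 2)" "is_square (478 * m + 2)"
  shows False
proof -
  have "odd m"
  proof
    assume "even m"
    then obtain k where "478 * m + 2 = 4 * (239 * k) + 2"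
      by (auto elim: evenE)
    moreover have "4 dvd 478 * m + 2"
      using even_square_dvd_4[OF assms(3)] by simp
    ultimately have "4 dvd (2::int)"
      by (metis dvd_add_right_iff dvd_triv_left)
    then show False
      by simp
  qed
  then have "8 dvd (41 * m + 2 - 1) + (239 * m + 2 - 1)"
    using assms(1,2) by (intro dvd_add odd_square_dvd_8) simp_all
  also have "\<dots> = 8 * (35 * m) + 2"
    by simp
  finally have "8 dvd (2::int)"
    by (metis dvd_add_right_iff dvd_triv_left)
  then show False
    by simp
qed

theorem theorem4:
  shows "non_extendable 2 {41, 239, 478}"
proof -
  have "is_square (41 * 239 + 2 :: int)" "is_square (41 * 478 + 2 :: int)"
      "is_square (239 * 478 + 2 :: int)"
    using is_nth_power_nth_power[of 2 "99::int"] is_nth_power_nth_power[of 2 "140::int"]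
      is_nth_power_nth_power[of 2 "338::int"]
    by simp_all
  then have "P_set 2 3 {41, 239, 478}"
    by (auto simp: P_set_def pairwise_insert)
  moreover have "\<not> P_set 2 4 (insert m {41, 239, 478})" if "m \<notin> {41, 239, 478}" for m
  proof
    assume "P_set 2 4 (insert m {41, 239, 478})"
    then have "is_square (41 * m + 2)" "is_square (239 * m + 2)" "is_square (478 * m + 2)"
      using that by (auto simp: P_set_def pairwise_insert)
    then show False
      by (rule not_all_squares)
  qed
  ultimately show ?thesis
    by (auto simp: non_extendable_def)
qed

end
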